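(* Let $T$ be a tree with $\ell(T)$ leaves, let $n_1, \ldots, n_{\ell(T)}$ be positive integers, and let $s = \mathrm{sg}(K^{T}_{n_1, \ldots, n_{\ell(T)}})$. If $G$ is a connected graph with $n(G) \leq s/2$, then $$\mathrm{sg}(K^{T}_{n_1, \ldots, n_{\ell(T)}} \,\square\, G) = s.$$
   Context: For a tree $T$ of order at least 3 with leaves $l_1,\ldots,l_{\ell(T)}$ and positive integers $n_1,\ldots,n_{\ell(T)}$, the clique tree $K^{T}_{n_1,\ldots,n_{\ell(T)}}$ is obtained from $T$ by replacing each leaf $l_i$ by a complete graph of order $n_i$, each vertex of which is joined by an edge to the (unique) neighbor of $l_i$ in $T$. For $T=K_2$ one sets $K^{K_2}_{n_1,n_2}=K_{n_1+n_2}$. $n(G)$ is the order of $G$, and $\square$ is the Cartesian product (vertex set $V(G)\times V(H)$, $(g,h)\sim(g',h')$ iff either $g=g'$ and $hh'\in E(H)$, or $h=h'$ and $gg'\in E(G)$). For a connected graph $G$ and $S\subseteq V(G)$, $S$ is a strong geodetic set if one can fix, for each unordered pair of distinct $x,y\in S$, a single shortest $x,y$-path so that the union of the vertex sets of the chosen paths is $V(G)$; $\mathrm{sg}(G)$ is the minimum size of a strong geodetic set. *)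

theory Defs
  imports Complex_Main "Graph_Theory.Graph_Theory"
begin

text \<open>
  A finite simple undirected graph is a \<^locale>\<open>pair_graph\<close>: a loopless digraph without parallel
  arcs whose arc relation is symmetric. The library's \<^const>\<open>Digraph_Component.connected\<close>
  includes nonemptiness.
\<close>

text \<open>
  The library's \<^const>\<open>Digraph_Component.tree\<close> is of no use here: in a symmetric digraph the
  closed walk \<open>a, b, a\<close> is a \<^const>\<open>pre_digraph.cycle\<close>. The cycles of the underlying
  undirected simple graph are those of length at least 3.
\<close>

definition undirected_tree :: "'a pair_pre_digraph \<Rightarrow> bool" where
  "undirected_tree T \<longleftrightarrow> pair_graph T \<and> Digraph_Component.connected (with_proj T) \<and>
     \<not> (\<exists>p. pre_digraph.cycle (with_proj T) p \<and> 3 \<le> length p)"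

definition leaves :: "'a pair_pre_digraph \<Rightarrow> 'a set" where
  "leaves T = {v \<in> pverts T. out_degree (with_proj T) v = 1}"

text \<open>
  The leaf \<open>l\<close> becomes the clique \<open>{l} \<times> {0..<n l}\<close>, and every other vertex \<open>v\<close> becomes \<open>(v, 0)\<close>.
  The values of \<open>n\<close> outside the leaves are irrelevant. In a tree of order at least 3 no two leaves
  are adjacent, so the second disjunct joins each clique to the neighbour of its leaf and keeps the
  other edges of \<open>T\<close>. For \<open>T = K\<^sub>2\<close> both vertices are leaves, and the same formula gives the complete
  graph on \<open>n\<^sub>1 + n\<^sub>2\<close> vertices (lemma \<open>clique_tree_K2\<close>).
\<close>

definition clique_tree :: "'a pair_pre_digraph \<Rightarrow> ('a \<Rightarrow> nat) \<Rightarrow> ('a \<times> nat) pair_pre_digraph" where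
  "clique_tree T n =
    (let V = (SIGMA v:pverts T. {0..<(if v \<in> leaves T then n v else 1)})
     in \<lparr> pverts = V,
          parcs = {((u, i), (v, j)) | u i v j. (u, i) \<in> V \<and> (v, j) \<in> V \<and>
                     (u = v \<and> i \<noteq> j \<or> (u, v) \<in> parcs T)} \<rparr>)"

lemma clique_tree_K2:
  assumes K2: "K\<^bsub>2\<^esub> (with_proj T)" and V2: "pverts T = {a, b}" and ab: "a \<noteq> b"
  shows "K\<^bsub>n a + n b\<^esub> (with_proj (clique_tree T n))"
proof -
  have "parcs T = {(u, v). (u, v) \<in> {a, b} \<times> {a, b} \<and> u \<noteq> v}"
    using K2 unfolding complete_digraph_pair_def V2 by blast
  then have arcs: "parcs T = {(a, b), (b, a)}"
    using ab by blast
  have out: "out_arcs (with_proj T) a = {(a, b)}" "out_arcs (with_proj T) b = {(b, a)}"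
    unfolding out_arcs_def with_proj_simps arcs using ab by force+
  have L: "leaves T = {a, b}"
    unfolding leaves_def out_degree_def V2 using out by auto
  have V: "pverts (clique_tree T n) = {a} \<times> {0..<n a} \<union> {b} \<times> {0..<n b}"
    unfolding clique_tree_def Let_def L V2 by auto
  have "card (pverts (clique_tree T n)) = card ({a} \<times> {0..<n a}) + card ({b} \<times> {0..<n b})"
    unfolding V using ab by (intro card_Un_disjoint) auto
  then have "card (pverts (clique_tree T n)) = n a + n b"
    by (simp add: card_cartesian_product)
  moreover have "finite (pverts (clique_tree T n))"
    unfolding V by simp
  moreover have "parcs (clique_tree T n) =
      {(x, y). (x, y) \<in> pverts (clique_tree T n) \<times> pverts (clique_tree T n) \<and> x \<noteq> y}"
  proof (rule set_eqI)
    fix e :: "('a \<times> nat) \<times> ('a \<times> nat)"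
    obtain u i v j where e: "e = ((u, i), (v, j))" by (metis surj_pair)
    have "e \<in> parcs (clique_tree T n) \<longleftrightarrow>
        (u, i) \<in> pverts (clique_tree T n) \<and> (v, j) \<in> pverts (clique_tree T n) \<and>
        (u = v \<and> i \<noteq> j \<or> (u, v) \<in> parcs T)"
      unfolding clique_tree_def Let_def e by simp
    also have "\<dots> \<longleftrightarrow>
        (u, i) \<in> pverts (clique_tree T n) \<and> (v, j) \<in> pverts (clique_tree T n) \<and>
        (u, i) \<noteq> (v, j)"
      unfolding V arcs using ab by fastforce
    finally show "e \<in> parcs (clique_tree T n) \<longleftrightarrow>
        e \<in> {(x, y). (x, y) \<in> pverts (clique_tree T n) \<times> pverts (clique_tree T n) \<and> x \<noteq> y}"
      unfolding e by blast
  qed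
  ultimately show ?thesis unfolding complete_digraph_pair_def by blast
qed

definition cart_prod :: "'a pair_pre_digraph \<Rightarrow> 'b pair_pre_digraph \<Rightarrow> ('a \<times> 'b) pair_pre_digraph"
    (infixl \<open>\<box>\<close> 70) where
  "G \<box> H =
    \<lparr> pverts = pverts G \<times> pverts H,
      parcs = {((g, h), (g', h')) | g h g' h'.
                 g = g' \<and> g \<in> pverts G \<and> (h, h') \<in> parcs H \<or>
                 h = h' \<and> h \<in> pverts H \<and> (g, g') \<in> parcs G} \<rparr>"

definition shortest_path :: "'a pair_pre_digraph \<Rightarrow> 'a vwalk \<Rightarrow> bool" where
  "shortest_path G p \<longleftrightarrow> vpath p (with_proj G) \<and>
     (\<forall>q. vpath q (with_proj G) \<and> hd q = hd p \<and> last q = last p \<longrightarrow>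
        vwalk_length p \<le> vwalk_length q)"

text \<open>
  The choice function \<open>P\<close> is indexed by the two-element subsets of \<open>S\<close>, so that exactly one path is
  fixed for each unordered pair; its orientation does not matter.
\<close>

definition strong_geodetic_set :: "'a pair_pre_digraph \<Rightarrow> 'a set \<Rightarrow> bool" where
  "strong_geodetic_set G S \<longleftrightarrow> S \<subseteq> pverts G \<and>
     (\<exists>P. (\<forall>x\<in>S. \<forall>y\<in>S. x \<noteq> y \<longrightarrow>
              shortest_path G (P {x, y}) \<and> {hd (P {x, y}), last (P {x, y})} = {x, y}) \<and>
          (\<Union>e\<in>{{x, y} | x y. x \<in> S \<and> y \<in> S \<and> x \<noteq> y}. set (P e)) = pverts G)"

text \<open>
  For a connected graph of order at least 2 the whole vertex set is strong geodetic, so the minimum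
  exists. With one vertex there are no pairs and the value is unspecified.
\<close>

definition sg :: "'a pair_pre_digraph \<Rightarrow> nat" where
  "sg G = (LEAST k. \<exists>S. strong_geodetic_set G S \<and> card S = k)"

end

theory Submission
  imports Defs
begin

text \<open>
  Let \<open>X\<close> be the union of the leaf cliques of the clique tree \<open>K\<close>. Its vertices are simplicial, hence never interior to a
  geodesic; since geodesics of a Cartesian product project to geodesics, every strong geodetic set
  of \<open>K \<box> G\<close> meets each fibre over \<open>X\<close>, and so has at least \<open>card X\<close> elements. Likewise
  \<open>X\<close> is a minimum strong geodetic set of \<open>K\<close>, because every other vertex separates two elements
  of \<open>X\<close>.

  For the upper bound take \<open>{(x, f x) | x \<in> X}\<close>, where every \<open>g\<close> in \<open>G\<close> has at least two preimages
  under \<open>f\<close>. Orient the pairs from different classes of \<open>f\<close> so that every \<open>x\<close> has an out-neighbour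
  in every class other than its own, and let the path of an oriented pair \<open>x \<rightarrow> y\<close> first move to
  \<open>(x, f y)\<close> and then cross the layer of \<open>f y\<close>. This covers the fibres over \<open>X\<close>. Within the layer
  of \<open>g\<close>, the pairs inside the class of \<open>g\<close> and those oriented into it connect all of \<open>X\<close>, so some
  pair is separated by any given vertex outside \<open>X\<close>, which therefore lies on its path.
\<close>

section \<open>Distances and shortest paths\<close>

text \<open>Defined on arc relations, so that distances can be handled through relation powers. For
  unreachable pairs the \<open>LEAST\<close> is unspecified, hence the reachability premises
  below.\<close>

definition gdist :: "'a rel \<Rightarrow> 'a \<Rightarrow> 'a \<Rightarrow> nat" where
  "gdist E x y = (LEAST k. (x, y) \<in> E ^^ k)"

lemma gdist_le: "(x, y) \<in> E ^^ k \<Longrightarrow> gdist E x y \<le> k"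
  unfolding gdist_def by (rule Least_le)

lemma relpow_gdist: "(x, y) \<in> E\<^sup>* \<Longrightarrow> (x, y) \<in> E ^^ gdist E x y"
  unfolding gdist_def by (metis LeastI rtrancl_imp_relpow)

lemma gdist_triangle:
  assumes "(x, y) \<in> E\<^sup>*" and "(y, z) \<in> E\<^sup>*"
  shows "gdist E x z \<le> gdist E x y + gdist E y z"
  using relpow_gdist[OF assms(1)] relpow_gdist[OF assms(2)]
  by (intro gdist_le) (auto simp: relpow_add)

section \<open>Walks as powers of the arc relation\<close>

lemma relpow_imp_vwalk:
  assumes "pair_wf_digraph G" and "(x, y) \<in> parcs G ^^ k" and "y \<in> pverts G"
  shows "\<exists>p. vwalk p (with_proj G) \<and> hd p = x \<and> last p = y \<and> length p = Suc k"
  using assms(2)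
proof (induction k arbitrary: x)
  case 0
  then show ?case using assms(3) by (intro exI[of _ "[x]"]) auto
next
  case (Suc k)
  obtain z where z: "(x, z) \<in> parcs G" "(z, y) \<in> parcs G ^^ k"
    using Suc.prems by (meson relpow_Suc_D2)
  obtain p where p: "vwalk p (with_proj G)" "hd p = z" "last p = y" "length p = Suc k"
    using Suc.IH[OF z(2)] by blast
  have "vwalk (x # p) (with_proj G)"
    using p z(1) pair_wf_digraph.in_arcsD1[OF assms(1)] by (intro vwalk_consI) auto
  then show ?case using p by (intro exI[of _ "x # p"]) auto
qed

lemma vwalk_imp_relpow:
  "vwalk p (with_proj G) \<Longrightarrow> (hd p, last p) \<in> parcs G ^^ (length p - 1)"
proof (induction p rule: vwalk_induct)
  case (Cons u v es)
  then have "(u, last (v # es)) \<in> parcs G ^^ Suc (length (v # es) - 1)"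
    by (intro relpow_Suc_I2) auto
  then show ?case by simp
qed auto

lemma vwalk_imp_rtrancl: "vwalk p (with_proj G) \<Longrightarrow> (hd p, last p) \<in> (parcs G)\<^sup>*"
  using vwalk_imp_relpow relpow_imp_rtrancl by metis

lemma vwalk_append_relpow:
  assumes "vwalk (xs @ m # ys) (with_proj G)"
  shows "(hd (xs @ [m]), m) \<in> parcs G ^^ length xs" "(m, last (m # ys)) \<in> parcs G ^^ length ys"
proof -
  have "vwalk (xs @ [m]) (with_proj G)"
    using vwalkI_append_l[of "xs @ [m]" ys "with_proj G"] assms by simp
  then show "(hd (xs @ [m]), m) \<in> parcs G ^^ length xs"
    using vwalk_imp_relpow[of "xs @ [m]" G] by simp
  have "vwalk (m # ys) (with_proj G)"
    using vwalkI_append_r[of "m # ys" xs "with_proj G"] assms by simp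
  then show "(m, last (m # ys)) \<in> parcs G ^^ length ys"
    using vwalk_imp_relpow[of "m # ys" G] by simp
qed

lemma vwalk_map:
  assumes "vwalk p (with_proj H)"
    and "\<And>a. a \<in> pverts H \<Longrightarrow> f a \<in> pverts H'"
    and "\<And>a b. (a, b) \<in> parcs H \<Longrightarrow> (f a, f b) \<in> parcs H'"
    and "pair_wf_digraph H'"
  shows "vwalk (map f p) (with_proj H')"
  using assms(1)
proof (induction p rule: vwalk_induct)
  case (Base u)
  then show ?case using assms(2) by auto
next
  case (Cons u v es)
  then have "(f u, f v) \<in> parcs H'" using assms(3) by auto
  then show ?case using Cons pair_wf_digraph.in_arcsD1[OF assms(4)]
    by (auto intro!: vwalk_consI)
qed

text \<open>Distinctness comes for free: cutting out the stretch between two occurrences of a vertex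
  would leave fewer arcs than the distance.\<close>

lemma shortest_pathI:
  assumes w: "vwalk p (with_proj G)" and len: "length p \<le> Suc (gdist (parcs G) (hd p) (last p))"
  shows "shortest_path G p"
proof -
  have "distinct p"
  proof (rule ccontr)
    assume "\<not> distinct p"
    then obtain xs ys zs a where p: "p = xs @ [a] @ ys @ [a] @ zs"
      using not_distinct_decomp by blast
    have "(hd (xs @ [a]), a) \<in> parcs G ^^ length xs"
      using vwalk_append_relpow(1)[of xs a "ys @ a # zs" G] w p by simp
    moreover have "(a, last (a # zs)) \<in> parcs G ^^ length zs"
      using vwalk_append_relpow(2)[of "xs @ a # ys" a zs G] w p by simp
    moreover have "hd p = hd (xs @ [a])" "last p = last (a # zs)"
      unfolding p by (cases xs; simp)+
    ultimately have "(hd p, last p) \<in> parcs G ^^ (length xs + length zs)"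
      by (auto simp: relpow_add)
    from gdist_le[OF this] len p show False by simp
  qed
  moreover have "length p \<le> length q" if "vpath q (with_proj G)" "hd q = hd p" "last q = last p" for q
  proof -
    have "vwalk q (with_proj G)" using that by auto
    with vwalk_imp_relpow[of q G] have "gdist (parcs G) (hd p) (last p) \<le> length q - 1"
      using that by (intro gdist_le) auto
    moreover have "q \<noteq> []" using \<open>vwalk q (with_proj G)\<close> by auto
    ultimately show ?thesis using len by (cases q) auto
  qed
  ultimately show ?thesis
    using w unfolding shortest_path_def by (auto intro: diff_le_mono)
qed

lemma ex_shortest_path:
  assumes "pair_wf_digraph G" and "(x, y) \<in> (parcs G)\<^sup>*" and "y \<in> pverts G"
  shows "\<exists>p. shortest_path G p \<and> hd p = x \<and> last p = y \<and> length p = Suc (gdist (parcs G) x y)"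
  using relpow_imp_vwalk[OF assms(1) relpow_gdist[OF assms(2)] assms(3)]
  by (metis order_refl shortest_pathI)

lemma shortest_path_vwalk: "shortest_path G p \<Longrightarrow> vwalk p (with_proj G)"
  unfolding shortest_path_def by auto

lemma shortest_path_verts: "shortest_path G p \<Longrightarrow> set p \<subseteq> pverts G"
  by (auto dest!: shortest_path_vwalk simp: vwalk_def)

lemma shortest_path_end_in_set:
  assumes "shortest_path G p" and "{hd p, last p} = {a, b}"
  shows "a \<in> set p"
proof -
  have "p \<noteq> []" using shortest_path_vwalk[OF assms(1)] by auto
  then have "{hd p, last p} \<subseteq> set p" by simp
  then show ?thesis unfolding assms(2) by blast
qed

text \<open>\<open>shortest_path\<close> compares \<open>p\<close> with paths only, but some path
  attains \<open>gdist\<close>, so \<open>p\<close> has at most that many arcs. Cutting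
  \<open>p\<close> at \<open>m\<close> then bounds both summands.\<close>

lemma shortest_path_between:
  assumes wf: "pair_wf_digraph G" and sp: "shortest_path G p" and m: "m \<in> set p"
  shows "gdist (parcs G) (hd p) m + gdist (parcs G) m (last p) \<le> gdist (parcs G) (hd p) (last p)"
    and "(hd p, m) \<in> (parcs G)\<^sup>*" "(m, last p) \<in> (parcs G)\<^sup>*"
proof -
  have w: "vwalk p (with_proj G)" using sp by (rule shortest_path_vwalk)
  then have "last p \<in> pverts G" by (auto simp: vwalk_def)
  then obtain q where q: "shortest_path G q" "hd q = hd p" "last q = last p"
      "length q = Suc (gdist (parcs G) (hd p) (last p))"
    using ex_shortest_path[OF wf vwalk_imp_rtrancl[OF w]] by blast
  have "length p - 1 \<le> length q - 1"
    using sp q(1-3) unfolding shortest_path_def by simp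
  then have len: "length p - 1 \<le> gdist (parcs G) (hd p) (last p)" using q by simp
  obtain xs ys where p: "p = xs @ m # ys" using m by (meson split_list)
  have "hd p = hd (xs @ [m])" "last p = last (m # ys)"
    unfolding p by (cases xs; simp)+
  then have *: "(hd p, m) \<in> parcs G ^^ length xs" "(m, last p) \<in> parcs G ^^ length ys"
    using vwalk_append_relpow[of xs m ys G] w p by simp_all
  show "gdist (parcs G) (hd p) m + gdist (parcs G) m (last p) \<le> gdist (parcs G) (hd p) (last p)"
    using *[THEN gdist_le] len p by simp
  show "(hd p, m) \<in> (parcs G)\<^sup>*" "(m, last p) \<in> (parcs G)\<^sup>*"
    using * by (auto intro: relpow_imp_rtrancl)
qed

text \<open>The vertex \<open>c\<close> before \<open>x\<close> on one geodesic and \<open>d\<close>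
  after it on the other are equal or adjacent, so bypassing \<open>x\<close> saves at least one
  step.\<close>

lemma simplicial_gdist_less:
  assumes simplicial: "\<And>a b. (a, x) \<in> E \<Longrightarrow> (x, b) \<in> E \<Longrightarrow> a = b \<or> (a, b) \<in> E"
    and ax: "(a, x) \<in> E\<^sup>*" and xb: "(x, b) \<in> E\<^sup>*" and ne: "a \<noteq> x" "b \<noteq> x"
  shows "gdist E a b < gdist E a x + gdist E x b"
proof -
  obtain i where i: "gdist E a x = Suc i"
    using relpow_gdist[OF ax] ne by (cases "gdist E a x") auto
  obtain j where j: "gdist E x b = Suc j"
    using relpow_gdist[OF xb] ne by (cases "gdist E x b") auto
  obtain c where c: "(a, c) \<in> E ^^ i" "(c, x) \<in> E"
    using relpow_gdist[OF ax] i by auto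
  obtain d where d: "(x, d) \<in> E" "(d, b) \<in> E ^^ j"
    using relpow_gdist[OF xb] j by (metis relpow_Suc_D2)
  have "(a, b) \<in> E ^^ (i + j) \<or> (a, b) \<in> E ^^ (i + Suc j)"
  proof (cases "c = d")
    case True
    then show ?thesis using c d by (auto simp: relpow_add)
  next
    case False
    then have "(c, b) \<in> E ^^ Suc j" using simplicial[OF c(2) d(1)] d(2) by (metis relpow_Suc_I2)
    then show ?thesis using c by (auto simp only: relpow_add)
  qed
  then show ?thesis using i j gdist_le by fastforce
qed

section \<open>Cartesian products\<close>

lemma cart_prod_simps [simp]:
  "pverts (K \<box> G) = pverts K \<times> pverts G"
  "((u, g), (v, h)) \<in> parcs (K \<box> G) \<longleftrightarrow>
     u = v \<and> u \<in> pverts K \<and> (g, h) \<in> parcs G \<or> g = h \<and> g \<in> pverts G \<and> (u, v) \<in> parcs K"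
  by (auto simp: cart_prod_def)

lemma pair_wf_digraph_cart_prod:
  assumes "pair_wf_digraph K" and "pair_wf_digraph G"
  shows "pair_wf_digraph (K \<box> G)"
  using pair_wf_digraph.wellformed'[OF assms(1)] pair_wf_digraph.wellformed'[OF assms(2)]
  by unfold_locales auto

text \<open>Every arc of the product is an arc in one coordinate and fixes the other, so the steps
  can be counted separately.\<close>

lemma relpow_cart_prodD:
  "(p, q) \<in> parcs (K \<box> G) ^^ k \<Longrightarrow>
     \<exists>i j. i + j = k \<and> (fst p, fst q) \<in> parcs K ^^ i \<and> (snd p, snd q) \<in> parcs G ^^ j"
proof (induction k arbitrary: q)
  case 0
  then show ?case by auto
next
  case (Suc k)
  then obtain r where r: "(p, r) \<in> parcs (K \<box> G) ^^ k" "(r, q) \<in> parcs (K \<box> G)" by auto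
  obtain i j where ij: "i + j = k" "(fst p, fst r) \<in> parcs K ^^ i" "(snd p, snd r) \<in> parcs G ^^ j"
    using Suc.IH[OF r(1)] by blast
  consider "fst r = fst q" "(snd r, snd q) \<in> parcs G" | "snd r = snd q" "(fst r, fst q) \<in> parcs K"
    using r(2) by (cases r; cases q) auto
  then show ?case
  proof cases
    case 1
    then have "(snd p, snd q) \<in> parcs G ^^ Suc j" using ij by auto
    then show ?thesis using 1 ij by (metis add_Suc_right)
  next
    case 2
    then have "(fst p, fst q) \<in> parcs K ^^ Suc i" using ij by auto
    then show ?thesis using 2 ij by (metis add_Suc)
  qed
qed

lemma gdist_cart_prod_ge:
  assumes "(p, q) \<in> (parcs (K \<box> G))\<^sup>*"
  shows "gdist (parcs K) (fst p) (fst q) + gdist (parcs G) (snd p) (snd q)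
           \<le> gdist (parcs (K \<box> G)) p q"
    and "(fst p, fst q) \<in> (parcs K)\<^sup>*" "(snd p, snd q) \<in> (parcs G)\<^sup>*"
proof -
  obtain i j where ij: "i + j = gdist (parcs (K \<box> G)) p q"
      "(fst p, fst q) \<in> parcs K ^^ i" "(snd p, snd q) \<in> parcs G ^^ j"
    using relpow_cart_prodD[OF relpow_gdist[OF assms]] by blast
  show "gdist (parcs K) (fst p) (fst q) + gdist (parcs G) (snd p) (snd q)
           \<le> gdist (parcs (K \<box> G)) p q"
    using gdist_le[OF ij(2)] gdist_le[OF ij(3)] ij(1) by linarith
  show "(fst p, fst q) \<in> (parcs K)\<^sup>*" "(snd p, snd q) \<in> (parcs G)\<^sup>*"
    using ij by (auto intro: relpow_imp_rtrancl)
qed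

text \<open>First move along the fibre of \<open>x\<close>, then cross the layer of \<open>h\<close> along a geodesic of \<open>K\<close>.\<close>

lemma ex_corner_path:
  assumes wfK: "pair_wf_digraph K" and wfG: "pair_wf_digraph G"
    and xy: "(x, y) \<in> (parcs K)\<^sup>*" and gh: "(g, h) \<in> (parcs G)\<^sup>*"
    and V: "x \<in> pverts K" "y \<in> pverts K" "h \<in> pverts G"
  obtains p q where "shortest_path (K \<box> G) p" "hd p = (x, g)" "last p = (y, h)"
    "length p = Suc (gdist (parcs K) x y + gdist (parcs G) g h)"
    "vwalk q (with_proj K)" "hd q = x" "last q = y" "set q \<times> {h} \<subseteq> set p"
proof -
  obtain q where q: "shortest_path K q" "hd q = x" "last q = y"
      "length q = Suc (gdist (parcs K) x y)"
    using ex_shortest_path[OF wfK xy] V by blast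
  obtain r where r: "shortest_path G r" "hd r = g" "last r = h"
      "length r = Suc (gdist (parcs G) g h)"
    using ex_shortest_path[OF wfG gh] V by blast
  note wf = pair_wf_digraph_cart_prod[OF wfK wfG]
  let ?r = "map (Pair x) r" and ?q = "map (\<lambda>u. (u, h)) q"
  have wr: "vwalk ?r (with_proj (K \<box> G))"
    using shortest_path_vwalk[OF r(1)] V wf by (auto intro!: vwalk_map)
  have wq: "vwalk ?q (with_proj (K \<box> G))"
    using shortest_path_vwalk[OF q(1)] V wf by (auto intro!: vwalk_map)
  have ne: "r \<noteq> []" "q \<noteq> []" using q r by auto
  have jn: "joinable ?r ?q" using q r ne by (auto simp: joinable_def last_map hd_map)
  let ?p = "vwalk_join ?r ?q"
  have w: "vwalk ?p (with_proj (K \<box> G))" by (rule vwalk_joinI_vwalk[OF wr wq jn])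
  have hd: "hd ?p = (x, g)" using vwalk_join_hd[OF jn] r ne by (simp add: hd_map)
  have last: "last ?p = (y, h)" using vwalk_join_last[OF jn] q ne by (simp add: last_map)
  have len: "length ?p = Suc (gdist (parcs K) x y + gdist (parcs G) g h)"
    using q r by (simp add: vwalk_join_def)
  \<comment> \<open>The join has no more arcs than the lower bound
    \<open>gdist_cart_prod_ge\<close>.\<close>
  have "shortest_path (K \<box> G) ?p"
  proof (rule shortest_pathI[OF w])
    show "length ?p \<le> Suc (gdist (parcs (K \<box> G)) (hd ?p) (last ?p))"
      using gdist_cart_prod_ge(1)[OF vwalk_imp_rtrancl[OF w]] unfolding hd last len by simp
  qed
  moreover have "set q \<times> {h} \<subseteq> set ?p"
    using jn unfolding vwalk_join_def2[OF jn] by (cases q) (auto simp: vwalk_join_def)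
  ultimately show thesis
    using that[of ?p q] hd last len q shortest_path_vwalk[OF q(1)] by blast
qed

lemma gdist_cart_prod_le:
  assumes "pair_wf_digraph K" and "pair_wf_digraph G"
    and "(x, y) \<in> (parcs K)\<^sup>*" and "(g, h) \<in> (parcs G)\<^sup>*"
    and "x \<in> pverts K" "y \<in> pverts K" "h \<in> pverts G"
  shows "gdist (parcs (K \<box> G)) (x, g) (y, h) \<le> gdist (parcs K) x y + gdist (parcs G) g h"
proof -
  obtain p where p: "shortest_path (K \<box> G) p" "hd p = (x, g)" "last p = (y, h)"
    "length p = Suc (gdist (parcs K) x y + gdist (parcs G) g h)"
    using ex_corner_path[OF assms] by metis
  show ?thesis using vwalk_imp_relpow[OF shortest_path_vwalk[OF p(1)]] p by (auto intro: gdist_le)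
qed

section \<open>Rules for strong geodetic sets\<close>

lemma strong_geodetic_set_subset: "strong_geodetic_set G S \<Longrightarrow> S \<subseteq> pverts G"
  by (simp add: strong_geodetic_set_def)

text \<open>Shortest paths never leave \<open>G\<close>, so covering is the only inclusion to show.
  \<open>P\<close> is constrained on singletons too, where a one-vertex path fits; this saves case
  splits.\<close>

lemma strong_geodetic_setI:
  assumes "S \<subseteq> pverts G"
    and P: "\<And>x y. x \<in> S \<Longrightarrow> y \<in> S \<Longrightarrow>
          shortest_path G (P {x, y}) \<and> {hd (P {x, y}), last (P {x, y})} = {x, y}"
    and cover: "\<And>v. v \<in> pverts G \<Longrightarrow> \<exists>x\<in>S. \<exists>y\<in>S. x \<noteq> y \<and> v \<in> set (P {x, y})"
  shows "strong_geodetic_set G S"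
proof -
  let ?U = "\<Union>e\<in>{{x, y} | x y. x \<in> S \<and> y \<in> S \<and> x \<noteq> y}. set (P e)"
  have "?U \<subseteq> pverts G"
  proof
    fix v assume "v \<in> ?U"
    then obtain x y where "x \<in> S" "y \<in> S" "v \<in> set (P {x, y})" by blast
    then show "v \<in> pverts G" using P[of x y] shortest_path_verts by blast
  qed
  moreover have "pverts G \<subseteq> ?U"
  proof
    fix v assume "v \<in> pverts G"
    then obtain x y where "x \<in> S" "y \<in> S" "x \<noteq> y" "v \<in> set (P {x, y})" using cover by blast
    then show "v \<in> ?U" by (intro UN_I[of "{x, y}"]) blast+
  qed
  ultimately have "?U = pverts G" by (rule subset_antisym)
  then show ?thesis
    unfolding strong_geodetic_set_def using assms(1) P by blast
qed

lemma strong_geodetic_setE: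
  assumes "strong_geodetic_set G S" and "v \<in> pverts G"
  obtains p a b where "a \<in> S" "b \<in> S" "shortest_path G p" "{hd p, last p} = {a, b}" "v \<in> set p"
proof -
  obtain P where P: "\<forall>a\<in>S. \<forall>b\<in>S. a \<noteq> b \<longrightarrow>
        shortest_path G (P {a, b}) \<and> {hd (P {a, b}), last (P {a, b})} = {a, b}"
      "(\<Union>e\<in>{{a, b} | a b. a \<in> S \<and> b \<in> S \<and> a \<noteq> b}. set (P e)) = pverts G"
    using assms unfolding strong_geodetic_set_def by blast
  obtain a b where "a \<in> S" "b \<in> S" "a \<noteq> b" "v \<in> set (P {a, b})"
    using assms(2) unfolding P(2)[symmetric] by blast
  then show thesis using that[of a b "P {a, b}"] P(1) by blast
qed

lemma sg_eqI:
  assumes "strong_geodetic_set G S" and "card S = k"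
    and "\<And>S'. strong_geodetic_set G S' \<Longrightarrow> k \<le> card S'"
  shows "sg G = k"
  unfolding sg_def using assms by (intro Least_equality) auto

section \<open>Graphs spanned by their simplicial vertices\<close>

text \<open>Its reflexive transitive closure is reachability after deleting \<open>v\<close>, apart
  from the trivial pair \<open>(v, v)\<close>.\<close>

definition avoiding :: "'a rel \<Rightarrow> 'a \<Rightarrow> 'a rel" where
  "avoiding E v = {(a, b) \<in> E. a \<noteq> v \<and> b \<noteq> v}"

text \<open>Used in contraposition: a walk between vertices separated by \<open>v\<close> passes
  through \<open>v\<close>.\<close>

lemma vwalk_avoiding:
  "vwalk q (with_proj K) \<Longrightarrow> v \<notin> set q \<Longrightarrow> (hd q, last q) \<in> (avoiding (parcs K) v)\<^sup>*"
proof (induction q rule: vwalk_induct)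
  case (Cons a b es)
  then have "(a, b) \<in> avoiding (parcs K) v" "(b, last (b # es)) \<in> (avoiding (parcs K) v)\<^sup>*"
    by (auto simp: avoiding_def)
  then show ?case by (simp add: converse_rtrancl_into_rtrancl)
qed auto

lemma sym_avoiding: "sym E \<Longrightarrow> (a, b) \<in> (avoiding E v)\<^sup>* \<Longrightarrow> (b, a) \<in> (avoiding E v)\<^sup>*"
proof -
  assume "sym E" "(a, b) \<in> (avoiding E v)\<^sup>*"
  moreover from \<open>sym E\<close> have "sym (avoiding E v)" by (auto simp: sym_def avoiding_def)
  ultimately show ?thesis by (meson sym_rtrancl symD)
qed

text \<open>
  The classes of \<open>f\<close> have at least two elements each, and \<open>\<tau> x g\<close> is a member of the class \<open>g\<close>
  assigned to \<open>x\<close>. Read \<open>x \<rightarrow> \<tau> x g\<close> as an orientation of pairs from distinct classes: picking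
  \<open>A g \<noteq> B g\<close> in each class and orienting the 4-cycle \<open>A g \<rightarrow> A h \<rightarrow> B g \<rightarrow> B h \<rightarrow> A g\<close>
  for \<open>g < h\<close>, no pair is used in both directions.
\<close>

lemma ex_oriented_classes:
  fixes X :: "'a set" and V :: "'b set"
  assumes "finite X" "finite V" "V \<noteq> {}" and le: "2 * card V \<le> card X"
  obtains f :: "'a \<Rightarrow> 'b" and \<tau> :: "'a \<Rightarrow> 'b \<Rightarrow> 'a"
  where "\<And>x. f x \<in> V"
    and "\<And>x g. g \<in> V \<Longrightarrow> \<tau> x g \<in> X \<and> f (\<tau> x g) = g"
    and "\<And>x y. f x \<noteq> f y \<Longrightarrow> y = \<tau> x (f y) \<Longrightarrow> x \<noteq> \<tau> y (f x)"
proof -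
  have "card (V \<times> (UNIV :: bool set)) \<le> card X"
    using le by (simp add: card_cartesian_product)
  then obtain \<phi> where \<phi>: "\<phi> ` (V \<times> (UNIV :: bool set)) \<subseteq> X" "inj_on \<phi> (V \<times> UNIV)"
    using card_le_inj[of "V \<times> (UNIV :: bool set)" X] assms by auto
  obtain g0 where g0: "g0 \<in> V" using assms by auto
  obtain \<iota> :: "'b \<Rightarrow> nat" where \<iota>: "inj_on \<iota> V"
    using finite_imp_inj_to_nat_seg[OF \<open>finite V\<close>] by blast
  \<comment> \<open>Elements of \<open>X\<close> outside the image of \<open>\<phi>\<close> all join
    the class \<open>g0\<close>.\<close>
  define f where "f x = (if x \<in> \<phi> ` (V \<times> UNIV) then fst (inv_into (V \<times> UNIV) \<phi> x) else g0)" for x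
  define A where "A g = \<phi> (g, True)" for g
  define B where "B g = \<phi> (g, False)" for g
  \<comment> \<open>Elements other than \<open>A g\<close> and \<open>B g\<close> always point to
    some \<open>A h\<close> and are never pointed at.\<close>
  define \<tau> where "\<tau> x h = (if \<iota> (f x) < \<iota> h then if x = B (f x) then B h else A h
                           else if x = A (f x) then B h else A h)" for x h
  have fV: "f x \<in> V" for x
  proof (cases "x \<in> \<phi> ` (V \<times> UNIV)")
    case True
    then have "inv_into (V \<times> UNIV) \<phi> x \<in> V \<times> UNIV" by (rule inv_into_into)
    then show ?thesis using True unfolding f_def by auto
  qed (simp add: f_def g0)
  have f\<phi>: "f (\<phi> (g, b)) = g" if "g \<in> V" for g b
    unfolding f_def using \<phi>(2) that by (simp add: inv_into_f_f)
  have AB: "A g \<in> X" "B g \<in> X" "f (A g) = g" "f (B g) = g" "A g \<noteq> B g" if "g \<in> V" for g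
    using \<phi>(1) inj_onD[OF \<phi>(2), of "(g, True)" "(g, False)"] f\<phi>[OF that] that
    by (auto simp: A_def B_def)
  have no_cycle: False
    if "\<iota> (f x) < \<iota> (f y)" "y = \<tau> x (f y)" "x = \<tau> y (f x)" for x y
  proof -
    have "y = (if x = B (f x) then B (f y) else A (f y))" using that by (simp add: \<tau>_def)
    moreover have "x = (if y = A (f y) then B (f x) else A (f x))" using that by (simp add: \<tau>_def)
    ultimately show False using AB(5)[OF fV[of x]] AB(5)[OF fV[of y]] by (metis (full_types))
  qed
  show thesis
  proof
    show "f x \<in> V" for x by (rule fV)
    show "\<tau> x g \<in> X \<and> f (\<tau> x g) = g" if "g \<in> V" for x g
      using AB[OF that] by (simp add: \<tau>_def)
    show "x \<noteq> \<tau> y (f x)" if "f x \<noteq> f y" "y = \<tau> x (f y)" for x y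
    proof -
      have "\<iota> (f x) < \<iota> (f y) \<or> \<iota> (f y) < \<iota> (f x)"
        using inj_onD[OF \<iota>, of "f x" "f y"] fV that(1) by (meson linorder_neqE_nat)
      then show ?thesis using no_cycle that(2) by blast
    qed
  qed
qed

text \<open>Isolates what the argument uses of a clique tree, with \<open>X\<close> standing for the
  union of the leaf cliques; trees enter only when the locale is instantiated.\<close>

locale simplicially_spanned =
  fixes K :: "'a pair_pre_digraph" and X :: "'a set"
  assumes wf: "pair_wf_digraph K"
    and fin: "finite (pverts K)"
    and sym: "sym (parcs K)"
    and conn: "u \<in> pverts K \<Longrightarrow> v \<in> pverts K \<Longrightarrow> (u, v) \<in> (parcs K)\<^sup>*"
    and X_verts: "X \<subseteq> pverts K"
    and card_X: "2 \<le> card X"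
    and simplicial: "x \<in> X \<Longrightarrow> (a, x) \<in> parcs K \<Longrightarrow> (x, b) \<in> parcs K \<Longrightarrow> a = b \<or> (a, b) \<in> parcs K"
    and separated: "v \<in> pverts K - X \<Longrightarrow> \<exists>x\<in>X. \<exists>y\<in>X. (x, y) \<notin> (avoiding (parcs K) v)\<^sup>*"
begin

lemma finite_X: "finite X"
  using X_verts fin by (rule finite_subset)

lemma ex_other: "x \<in> X \<Longrightarrow> \<exists>y\<in>X. y \<noteq> x"
  using card_X by (metis card_le_Suc0_iff_eq finite_X not_less_eq_eq numeral_2_eq_2)

lemma subset_strong_geodetic_set:
  assumes "strong_geodetic_set K S"
  shows "X \<subseteq> S"
proof
  fix x assume x: "x \<in> X"
  then have "x \<in> pverts K" using X_verts by blast
  then obtain p a b where ab: "a \<in> S" "b \<in> S" and sp: "shortest_path K p"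
    and ends: "{hd p, last p} = {a, b}" and xp: "x \<in> set p"
    by (rule strong_geodetic_setE[OF assms])
  have "hd p = x \<or> last p = x"
  proof (rule ccontr)
    assume "\<not> ?thesis"
    then have "gdist (parcs K) (hd p) (last p)
        < gdist (parcs K) (hd p) x + gdist (parcs K) x (last p)"
      using shortest_path_between(2,3)[OF wf sp xp]
      by (intro simplicial_gdist_less simplicial[OF x]) auto
    with shortest_path_between(1)[OF wf sp xp] show False by simp
  qed
  then have "x \<in> {hd p, last p}" by auto
  then show "x \<in> S" unfolding ends using ab by blast
qed

text \<open>Any choice of geodesics works: a vertex of \<open>X\<close> is an end of some path, and
  any other vertex lies on the path of a pair it separates.\<close>

lemma strong_geodetic_set_simplicial: "strong_geodetic_set K X"
proof -
  define P where "P e = (SOME p. shortest_path K p \<and> {hd p, last p} = e)" for e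
  have P: "shortest_path K (P {x, y}) \<and> {hd (P {x, y}), last (P {x, y})} = {x, y}"
    if "x \<in> X" "y \<in> X" for x y
  proof -
    have "x \<in> pverts K" "y \<in> pverts K" using that X_verts by auto
    then obtain p where "shortest_path K p" "hd p = x" "last p = y"
      using ex_shortest_path[OF wf conn, of x y] by blast
    then have "shortest_path K p \<and> {hd p, last p} = {x, y}" by simp
    then show ?thesis unfolding P_def by (rule someI)
  qed
  have "\<exists>x\<in>X. \<exists>y\<in>X. x \<noteq> y \<and> v \<in> set (P {x, y})" if v: "v \<in> pverts K" for v
  proof (cases "v \<in> X")
    case True
    obtain y where y: "y \<in> X" "y \<noteq> v" using ex_other[OF True] by blast
    have "v \<in> set (P {v, y})"
      using P[OF True y(1)] by (elim conjE) (rule shortest_path_end_in_set)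
    then show ?thesis using True y by (intro bexI[of _ v] bexI[of _ y]) auto
  next
    case False
    then obtain x y where xy: "x \<in> X" "y \<in> X" "(x, y) \<notin> (avoiding (parcs K) v)\<^sup>*"
      using separated v by blast
    \<comment> \<open>The orientation of \<open>P {x, y}\<close> is unknown, so separation is needed
      in both directions.\<close>
    then have "(y, x) \<notin> (avoiding (parcs K) v)\<^sup>*" using sym_avoiding[OF sym] by blast
    then have "(hd (P {x, y}), last (P {x, y})) \<notin> (avoiding (parcs K) v)\<^sup>*"
      using P[OF xy(1,2)] xy(3) by (metis doubleton_eq_iff)
    moreover have "vwalk (P {x, y}) (with_proj K)"
      using P[OF xy(1,2)] by (blast intro: shortest_path_vwalk)
    ultimately have "v \<in> set (P {x, y})" using vwalk_avoiding[of "P {x, y}" K v] by metis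
    moreover have "x \<noteq> y" using xy(3) by auto
    ultimately show ?thesis using xy(1,2) by (intro bexI[of _ x] bexI[of _ y]) auto
  qed
  then show ?thesis using P X_verts by (intro strong_geodetic_setI[of X K P])
qed

lemma sg_eq: "sg K = card X"
proof (rule sg_eqI[OF strong_geodetic_set_simplicial refl])
  fix S assume S: "strong_geodetic_set K S"
  then have "finite S" using fin by (blast intro: finite_subset dest: strong_geodetic_set_subset)
  then show "card X \<le> card S" using subset_strong_geodetic_set[OF S] by (rule card_mono)
qed

end

section \<open>Strong geodetic sets of the product\<close>

locale simplicially_spanned_product = simplicially_spanned K X
  for K :: "'a pair_pre_digraph" and X :: "'a set" +
  fixes G :: "'b pair_pre_digraph"
  assumes wf_G: "pair_wf_digraph G"
    and fin_G: "finite (pverts G)"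
    and ne_G: "pverts G \<noteq> {}"
    and conn_G: "g \<in> pverts G \<Longrightarrow> h \<in> pverts G \<Longrightarrow> (g, h) \<in> (parcs G)\<^sup>*"
begin

lemmas wf_prod = pair_wf_digraph_cart_prod[OF wf wf_G]

text \<open>If both ends of the path covering \<open>(x, g)\<close> projected away from
  \<open>x\<close>, the shortcut past \<open>x\<close> in \<open>K\<close> and the triangle
  inequality in \<open>G\<close> would beat that path.\<close>

lemma subset_fst_strong_geodetic_set:
  assumes S: "strong_geodetic_set (K \<box> G) S"
  shows "X \<subseteq> fst ` S"
proof
  fix x assume x: "x \<in> X"
  obtain g where g: "g \<in> pverts G" using ne_G by auto
  then have "(x, g) \<in> pverts (K \<box> G)" using x X_verts by auto
  then obtain p a b where ab: "a \<in> S" "b \<in> S" and sp: "shortest_path (K \<box> G) p"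
    and ends: "{hd p, last p} = {a, b}" and xp: "(x, g) \<in> set p"
    by (rule strong_geodetic_setE[OF S])
  let ?d = "gdist (parcs K)" and ?e = "gdist (parcs G)"
  obtain u h where u: "hd p = (u, h)" by (cases "hd p")
  obtain v k where v: "last p = (v, k)" by (cases "last p")
  have S_verts: "S \<subseteq> pverts K \<times> pverts G" using strong_geodetic_set_subset[OF S] by simp
  have "hd p \<in> {a, b}" "last p \<in> {a, b}" unfolding ends[symmetric] by simp_all
  then have "hd p \<in> S" "last p \<in> S" using ab by auto
  then have "(u, h) \<in> S" "(v, k) \<in> S" unfolding u v by simp_all
  then have V: "u \<in> pverts K" "v \<in> pverts K" "h \<in> pverts G" "k \<in> pverts G" using S_verts by auto
  note between = shortest_path_between[OF wf_prod sp xp, unfolded u v]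
  have "u = x \<or> v = x"
  proof (rule ccontr)
    assume ne: "\<not> ?thesis"
    have "?d u v < ?d u x + ?d x v"
      using ne V x X_verts by (intro simplicial_gdist_less simplicial[OF x] conn) auto
    moreover have "?e h k \<le> ?e h g + ?e g k"
      using V g by (intro gdist_triangle conn_G)
    moreover have "gdist (parcs (K \<box> G)) (u, h) (v, k) \<le> ?d u v + ?e h k"
      using V by (intro gdist_cart_prod_le wf wf_G conn conn_G)
    ultimately show False
      using between(1) gdist_cart_prod_ge(1)[OF between(2)] gdist_cart_prod_ge(1)[OF between(3)]
      by simp
  qed
  then show "x \<in> fst ` S" using \<open>(u, h) \<in> S\<close> \<open>(v, k) \<in> S\<close> by force
qed

text \<open>The corner path turns at \<open>(x, h)\<close> and then follows a walk of
  \<open>K\<close> from \<open>x\<close> to \<open>y\<close> in the layer of \<open>h\<close>; that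
  walk meets every separating vertex.\<close>

lemma ex_separating_path:
  assumes "x \<in> X" "y \<in> X" "g \<in> pverts G" "h \<in> pverts G"
  obtains p where "shortest_path (K \<box> G) p" "hd p = (x, g)" "last p = (y, h)" "(x, h) \<in> set p"
    "\<And>v. (x, y) \<notin> (avoiding (parcs K) v)\<^sup>* \<Longrightarrow> (v, h) \<in> set p"
proof -
  have V: "x \<in> pverts K" "y \<in> pverts K" using assms X_verts by auto
  obtain p q where p: "shortest_path (K \<box> G) p" "hd p = (x, g)" "last p = (y, h)"
    and q: "vwalk q (with_proj K)" "hd q = x" "last q = y" "set q \<times> {h} \<subseteq> set p"
    using ex_corner_path[OF wf wf_G conn[OF V] conn_G[OF assms(3,4)] V assms(4)] by metis
  have "(v, h) \<in> set p" if "(x, y) \<notin> (avoiding (parcs K) v)\<^sup>*" for v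
    using vwalk_avoiding[OF q(1), of v] q that by blast
  moreover have "(x, h) \<in> set p" using q by (auto simp: vwalk_def)
  ultimately show thesis using that p by blast
qed

lemma ex_strong_geodetic_set:
  assumes le: "2 * card (pverts G) \<le> card X"
  shows "\<exists>S. strong_geodetic_set (K \<box> G) S \<and> card S = card X"
proof -
  obtain f \<tau> where fV: "\<And>x. f x \<in> pverts G"
    and \<tau>: "\<And>x g. g \<in> pverts G \<Longrightarrow> \<tau> x g \<in> X \<and> f (\<tau> x g) = g"
    and anti: "\<And>x y. f x \<noteq> f y \<Longrightarrow> y = \<tau> x (f y) \<Longrightarrow> x \<noteq> \<tau> y (f x)"
    using ex_oriented_classes[OF finite_X fin_G ne_G le] by metis
  let ?R = "\<lambda>v. (avoiding (parcs K) v)\<^sup>*" and ?c = "\<lambda>x. (x, f x)"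
  \<comment> \<open>Since \<open>e\<close> is unordered, the demand ranges over both readings of it;
    it binds for pairs within one class and for pairs oriented from \<open>x\<close> to
    \<open>y\<close>.\<close>
  define Q where "Q e p \<longleftrightarrow> shortest_path (K \<box> G) p \<and> {hd p, last p} = e \<and>
     (\<forall>x y. e = {?c x, ?c y} \<and> (f x = f y \<or> y = \<tau> x (f y)) \<longrightarrow>
        (x, f y) \<in> set p \<and> (\<forall>v. (x, y) \<notin> ?R v \<longrightarrow> (v, f y) \<in> set p))" for e p
  have ex: "\<exists>p. Q {?c x, ?c y} p" if "x \<in> X" "y \<in> X" for x y
  proof -
    \<comment> \<open>The path will run from \<open>a\<close> to \<open>b\<close>. The direction is
      chosen so that the reverse reading carries no demand unless the classes agree.\<close>
    obtain a b where ab: "a \<in> X" "b \<in> X" "{?c x, ?c y} = {?c a, ?c b}" "f a = f b \<or> a \<noteq> \<tau> b (f a)"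
    proof (cases "f x = f y \<or> x \<noteq> \<tau> y (f x)")
      case True
      then show thesis using that(1)[of x y] \<open>x \<in> X\<close> \<open>y \<in> X\<close> by blast
    next
      case False
      then have "y \<noteq> \<tau> x (f y)" using anti[of x y] by blast
      then show thesis using that(1)[of y x] \<open>x \<in> X\<close> \<open>y \<in> X\<close> by blast
    qed
    obtain p where p: "shortest_path (K \<box> G) p" "hd p = ?c a" "last p = ?c b" "(a, f b) \<in> set p"
      "\<And>v. (a, b) \<notin> ?R v \<Longrightarrow> (v, f b) \<in> set p"
      using ex_separating_path[OF ab(1,2) fV fV] by metis
    have "(x', f y') \<in> set p \<and> (\<forall>v. (x', y') \<notin> ?R v \<longrightarrow> (v, f y') \<in> set p)"
      if e: "{?c a, ?c b} = {?c x', ?c y'}" and o: "f x' = f y' \<or> y' = \<tau> x' (f y')" for x' y'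
    proof -
      consider "x' = a" "y' = b" | "x' = b" "y' = a" using e by (auto simp: doubleton_eq_iff)
      then show ?thesis
      proof cases
        case 1
        then show ?thesis using p by blast
      next
        case 2
        \<comment> \<open>Within one class the reverse reading asks for \<open>(b, f a)\<close>,
          which is the end of \<open>p\<close>, and separation is symmetric.\<close>
        then have "f b = f a" using o ab(4) by auto
        moreover have "p \<noteq> []" using shortest_path_vwalk[OF p(1)] by auto
        ultimately show ?thesis
          using 2 p last_in_set[of p] sym_avoiding[OF sym] by metis
      qed
    qed
    then have "Q {?c a, ?c b} p" unfolding Q_def using p by auto
    then show ?thesis unfolding ab(3) by blast
  qed
  define P where "P e = (SOME p. Q e p)" for e
  have QP: "Q {?c x, ?c y} (P {?c x, ?c y})" if "x \<in> X" "y \<in> X" for x y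
    unfolding P_def using ex[OF that] by (rule someI_ex)
  define S where "S = ?c ` X"
  have inj: "inj_on ?c X" by (auto simp: inj_on_def)
  have cover: "\<exists>x\<in>X. \<exists>y\<in>X. x \<noteq> y \<and> (v, g) \<in> set (P {?c x, ?c y})"
    if v: "v \<in> pverts K" and g: "g \<in> pverts G" for v g
  proof (cases "v \<in> X")
    case v: True
    show ?thesis
    \<comment> \<open>Either \<open>(v, g)\<close> belongs to \<open>S\<close> and is an end of a
      path, or it is the corner of the path from \<open>v\<close> to
      \<open>\<tau> v g\<close>.\<close>
    proof (cases "f v = g")
      case True
      obtain y where y: "y \<in> X" "y \<noteq> v" using ex_other[OF v] by blast
      let ?p = "P {?c v, ?c y}"
      have "?c v \<in> set ?p"
        using QP[OF v y(1)] unfolding Q_def by (elim conjE) (rule shortest_path_end_in_set)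
      then have "(v, g) \<in> set ?p" using True by simp
      then show ?thesis using v y by (intro bexI[of _ v] bexI[of _ y]) auto
    next
      case False
      let ?y = "\<tau> v g"
      have y: "?y \<in> X" "f ?y = g" using \<tau>[OF g] by auto
      moreover have "(v, f ?y) \<in> set (P {?c v, ?c ?y})"
        using QP[OF v y(1)] y unfolding Q_def by (metis (no_types, lifting))
      ultimately show ?thesis using v False by metis
    qed
  next
    case False
    then obtain x0 y0 where xy0: "x0 \<in> X" "y0 \<in> X" "(x0, y0) \<notin> ?R v" using separated v by blast
    have trans: "(a, c) \<in> ?R v" if "(a, b) \<in> ?R v" "(b, c) \<in> ?R v" for a b c
      using that by (rule rtrancl_trans)
    have symR: "(b, a) \<in> ?R v" if "(a, b) \<in> ?R v" for a b
      using sym_avoiding[OF sym that] .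
    define c where "c = \<tau> x0 g"
    have c: "c \<in> X" "f c = g" using \<tau>[OF g] by (auto simp: c_def)
    \<comment> \<open>With \<open>v\<close> deleted, \<open>x0\<close> and \<open>y0\<close> cannot
      both be connected to \<open>c\<close>.\<close>
    obtain z where z: "z \<in> X" "(z, c) \<notin> ?R v" using xy0 trans symR by metis
    define d where "d = \<tau> z g"
    have d: "d \<in> X" "f d = g" using \<tau>[OF g] by (auto simp: d_def)
    \<comment> \<open>Either \<open>v\<close> separates \<open>z\<close> from \<open>d\<close>, a
      pair oriented towards \<open>d\<close>, or it separates \<open>d\<close> from
      \<open>c\<close>, which both lie in the class \<open>g\<close>.\<close>
    obtain x y where xy: "x \<in> X" "y \<in> X" "(x, y) \<notin> ?R v" "f y = g" "f x = f y \<or> y = \<tau> x (f y)"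
    proof (cases "(z, d) \<in> ?R v")
      case True
      then have "(d, c) \<notin> ?R v" using z trans by blast
      then show thesis using that c d by metis
    next
      case False
      then show thesis using that[of z d] z d d_def by metis
    qed
    then have "(v, f y) \<in> set (P {?c x, ?c y})"
      using QP[OF xy(1,2)] unfolding Q_def by blast
    moreover have "x \<noteq> y" using xy(3) by auto
    ultimately show ?thesis using xy by metis
  qed
  have "strong_geodetic_set (K \<box> G) S"
  proof (rule strong_geodetic_setI)
    show "S \<subseteq> pverts (K \<box> G)" using X_verts fV by (auto simp: S_def)
    show "shortest_path (K \<box> G) (P {p, q}) \<and> {hd (P {p, q}), last (P {p, q})} = {p, q}"
      if pq: "p \<in> S" "q \<in> S" for p q
    proof -
      obtain x y where "x \<in> X" "y \<in> X" "p = ?c x" "q = ?c y" using pq by (auto simp: S_def)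
      then show ?thesis using QP[of x y] unfolding Q_def by blast
    qed
    show "\<exists>p\<in>S. \<exists>q\<in>S. p \<noteq> q \<and> w \<in> set (P {p, q})" if w: "w \<in> pverts (K \<box> G)" for w
    proof -
      obtain x y where "x \<in> X" "y \<in> X" "x \<noteq> y" "w \<in> set (P {?c x, ?c y})"
        using cover[of "fst w" "snd w"] w by auto
      then show ?thesis unfolding S_def by (intro bexI[of _ "?c x"] bexI[of _ "?c y"]) blast+
    qed
  qed
  moreover have "card S = card X" unfolding S_def using inj by (rule card_image)
  ultimately show ?thesis by blast
qed

lemma sg_cart_prod:
  assumes "2 * card (pverts G) \<le> card X"
  shows "sg (K \<box> G) = card X"
proof -
  obtain S where "strong_geodetic_set (K \<box> G) S" "card S = card X"
    using ex_strong_geodetic_set[OF assms] by blast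
  then show ?thesis
  proof (rule sg_eqI)
    fix S' assume S': "strong_geodetic_set (K \<box> G) S'"
    have "finite (pverts (K \<box> G))" using fin fin_G by simp
    then have "finite S'" using S' by (blast intro: finite_subset dest: strong_geodetic_set_subset)
    then have "card X \<le> card (fst ` S')"
      using subset_fst_strong_geodetic_set[OF S'] by (intro card_mono) auto
    also have "\<dots> \<le> card S'" using \<open>finite S'\<close> by (rule card_image_le)
    finally show "card X \<le> card S'" .
  qed
qed

end

section \<open>Clique trees\<close>

text \<open>\<open>pre_digraph.cycle\<close> is phrased for arc lists and wants all visited vertices
  but the first to be distinct, hence the form of the second premise.\<close>

lemma cycle_vwalk_arcs:
  assumes "vwalk (v # p @ [v]) (with_proj T)" and "distinct (p @ [v])"
  shows "pre_digraph.cycle (with_proj T) (vwalk_arcs (v # p @ [v]))"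
proof -
  have pcas: "pcas (hd q) (vwalk_arcs q) (last q) \<and> pawalk_verts (hd q) (vwalk_arcs q) = q"
    if "q \<noteq> []" for q :: "'a list"
    using that by (induction q rule: vwalk_arcs.induct) auto
  show ?thesis
    using assms pcas[of "v # p @ [v]"]
    unfolding pre_digraph.cycle_def pre_digraph.awalk_def
      cas_with_proj_eq awalk_verts_with_proj_eq
    by (intro exI[of _ v]) (auto simp: vwalk_def)
qed

text \<open>Reachability becomes a walk in the graph \<open>H\<close> with \<open>v\<close> deleted,
  which can be shortened to a path. The premise \<open>b \<noteq> v\<close> excludes the trivial
  pair \<open>(v, v)\<close>.\<close>

lemma rtrancl_avoiding_imp_vwalk:
  assumes wf: "pair_wf_digraph T" and ab: "(a, b) \<in> (avoiding (parcs T) v)\<^sup>*"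
    and b: "b \<in> pverts T" "b \<noteq> v"
  obtains p where "vwalk p (with_proj T)" "distinct p" "v \<notin> set p" "hd p = a" "last p = b"
proof -
  define H where "H = \<lparr>pverts = pverts T - {v}, parcs = avoiding (parcs T) v\<rparr>"
  have "pair_wf_digraph H"
    using pair_wf_digraph.wellformed'[OF wf] by unfold_locales (auto simp: H_def avoiding_def)
  moreover obtain k where "(a, b) \<in> parcs H ^^ k"
    using ab by (auto simp: H_def dest: rtrancl_imp_relpow)
  ultimately obtain q where q: "vwalk q (with_proj H)" "hd q = a" "last q = b"
    using relpow_imp_vwalk[of H a b k] b by (auto simp: H_def)
  have p: "vpath (vwalk_to_vpath q) (with_proj H)" "hd (vwalk_to_vpath q) = a"
      "last (vwalk_to_vpath q) = b"
    using q vwalk_to_vpath_vpath[of q] vwalk_to_vpath_hd[of q] vwalk_to_vpath_last[of q]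
    by auto
  show thesis
    using that[of "vwalk_to_vpath q"] p by (auto simp: vpath_def vwalk_def H_def avoiding_def)
qed

text \<open>Connectedness ignores the direction of arcs; symmetry turns it into directed
  reachability.\<close>

lemma connected_imp_rtrancl:
  assumes "pair_graph G" and "Digraph_Component.connected (with_proj G)"
    and "u \<in> pverts G" "v \<in> pverts G"
  shows "(u, v) \<in> (parcs G)\<^sup>*"
proof -
  interpret pair_graph G by fact
  have "strongly_connected (with_proj G)"
    using symmetric_connected_imp_strongly_connected[OF sym_arcs] assms by blast
  then have "u \<rightarrow>\<^sup>*\<^bsub>with_proj G\<^esub> v" using assms by (simp add: strongly_connected_def)
  from reachable_rtranclI[OF this] show ?thesis by simp
qed

section \<open>Branches and leaves of trees\<close>

locale undirected_tree_graph =
  fixes T :: "'a pair_pre_digraph"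
  assumes tree: "undirected_tree T" and card_ge_2: "2 \<le> card (pverts T)"
begin

lemma graph_T: "pair_graph T"
  using tree by (simp add: undirected_tree_def)

sublocale T: pair_graph T
  by (rule graph_T)

lemma sym_T: "sym (parcs T)"
  using T.arcs_symmetric by (auto simp: sym_def)

lemma wf_T: "pair_wf_digraph T" ..

text \<open>A path from \<open>a\<close> to \<open>b\<close> missing \<open>v\<close> closes up
  through \<open>v\<close>. As \<open>a \<noteq> b\<close>, it has at least two vertices, so the
  cycle has the length 3 that \<open>undirected_tree\<close> forbids.\<close>

lemma adjacent_separated:
  assumes "(v, a) \<in> parcs T" "(v, b) \<in> parcs T" "a \<noteq> b"
  shows "(a, b) \<notin> (avoiding (parcs T) v)\<^sup>*"
proof
  assume ab: "(a, b) \<in> (avoiding (parcs T) v)\<^sup>*"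
  have "b \<in> pverts T" "b \<noteq> v" using assms T.in_arcsD2 T.no_loops' by blast+
  then obtain p where p: "vwalk p (with_proj T)" "distinct p" "v \<notin> set p" "hd p = a" "last p = b"
    using rtrancl_avoiding_imp_vwalk[OF wf_T ab] by blast
  obtain c d r where r: "p = c # d # r" using p assms(3) by (cases p rule: vwalk_arcs.cases) auto
  have v: "v \<in> pverts T" "(b, v) \<in> parcs T" using assms T.in_arcsD1 T.arcs_symmetric by blast+
  have "vwalk (v # p @ [v]) (with_proj T)"
    using p v assms(1) by (auto simp: vwalk_def vwalk_arcs_append)
  then have "pre_digraph.cycle (with_proj T) (vwalk_arcs (v # p @ [v]))"
    using p by (intro cycle_vwalk_arcs) auto
  moreover have "length (vwalk_arcs (v # p @ [v])) = Suc (length p)"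
    using vwalk_length_simp[of "v # p @ [v]"] unfolding vwalk_length_def by simp
  then have "3 \<le> length (vwalk_arcs (v # p @ [v]))" using r by simp
  ultimately show False using tree unfolding undirected_tree_def by blast
qed

lemma leaf_iff: "v \<in> leaves T \<longleftrightarrow> v \<in> pverts T \<and> (\<exists>!w. (v, w) \<in> parcs T)"
proof -
  have "out_arcs (with_proj T) v = Pair v ` {w. (v, w) \<in> parcs T}" by (auto simp: out_arcs_def)
  then have "out_degree (with_proj T) v = card {w. (v, w) \<in> parcs T}"
    by (simp add: out_degree_def card_image inj_on_def)
  moreover have "card {w. (v, w) \<in> parcs T} = 1 \<longleftrightarrow> (\<exists>!w. (v, w) \<in> parcs T)"
    unfolding One_nat_def card_1_singleton_iff set_eq_iff by auto
  ultimately show ?thesis unfolding leaves_def by simp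
qed

lemma connected_T: "u \<in> pverts T \<Longrightarrow> v \<in> pverts T \<Longrightarrow> (u, v) \<in> (parcs T)\<^sup>*"
  using tree unfolding undirected_tree_def by (blast intro: connected_imp_rtrancl)

lemma ex_neighbour:
  assumes "v \<in> pverts T"
  shows "\<exists>w. (v, w) \<in> parcs T"
proof -
  obtain u where "u \<in> pverts T" "u \<noteq> v"
    using card_ge_2 by (metis card_le_Suc0_iff_eq T.pair_finite_verts assms not_less_eq_eq numeral_2_eq_2)
  then show ?thesis using connected_T[OF assms] by (metis converse_rtranclE)
qed

text \<open>
  The branches at a vertex are pairwise disjoint, so stepping away from \<open>v\<close> strictly shrinks the
  branch until it consists of a leaf.
\<close>

lemma ex_leaf_in_branch:
  "(v, a) \<in> parcs T \<Longrightarrow> \<exists>l\<in>leaves T. (a, l) \<in> (avoiding (parcs T) v)\<^sup>*"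
proof (induction "card {w. (a, w) \<in> (avoiding (parcs T) v)\<^sup>*}" arbitrary: v a rule: less_induct)
  case less
  let ?B = "\<lambda>v a. {w. (a, w) \<in> (avoiding (parcs T) v)\<^sup>*}"
  have av: "(a, v) \<in> parcs T" "a \<in> pverts T" "a \<noteq> v"
    using less.prems T.arcs_symmetric T.in_arcsD2 T.no_loops' by blast+
  show ?case
  proof (cases "a \<in> leaves T")
    case False
    then obtain c where c: "(a, c) \<in> parcs T" "c \<noteq> v" using av leaf_iff by blast
    have "c \<noteq> a" using c T.no_loops' by blast
    have ac: "(a, c) \<in> avoiding (parcs T) v" using c av by (simp add: avoiding_def)
    have cv: "(c, v) \<notin> (avoiding (parcs T) a)\<^sup>*" using adjacent_separated[of a c v] c av by blast
    \<comment> \<open>A walk from \<open>c\<close> avoiding \<open>a\<close> cannot reach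
      \<open>v\<close>, since \<open>a\<close> separates its neighbours \<open>c\<close> and
      \<open>v\<close>; so it stays in the branch of \<open>a\<close> at \<open>v\<close>.\<close>
    have sub: "(a, w) \<in> (avoiding (parcs T) v)\<^sup>*" if "(c, w) \<in> (avoiding (parcs T) a)\<^sup>*" for w
      using that
    proof induction
      case base
      show ?case using ac by blast
    next
      case (step y z)
      have "(c, z) \<in> (avoiding (parcs T) a)\<^sup>*" using step by (meson rtrancl.rtrancl_into_rtrancl)
      then have "y \<noteq> v" "z \<noteq> v" using step cv by blast+
      then have "(y, z) \<in> avoiding (parcs T) v" using step by (auto simp: avoiding_def)
      then show ?case using step by (meson rtrancl.rtrancl_into_rtrancl)
    qed
    \<comment> \<open>Strictness: \<open>a\<close> lies in its own branch at \<open>v\<close> but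
      not in the branch of \<open>c\<close> at \<open>a\<close>.\<close>
    have "(c, a) \<notin> (avoiding (parcs T) a)\<^sup>*"
      using \<open>c \<noteq> a\<close> by (auto elim: rtranclE simp: avoiding_def)
    then have "?B a c \<subset> ?B v a" using sub by blast
    moreover have "?B v a \<subseteq> pverts T"
      using av(2) by (auto elim: rtranclE simp: avoiding_def dest: T.in_arcsD2)
    ultimately have "card (?B a c) < card (?B v a)"
      using T.pair_finite_verts by (meson finite_subset psubset_card_mono)
    then show ?thesis using less.hyps[OF _ c(1)] sub by blast
  qed auto
qed

lemma clique_tree_simplicially_spanned:
  assumes pos: "\<And>l. l \<in> leaves T \<Longrightarrow> 0 < n l"
  shows "simplicially_spanned (clique_tree T n) (SIGMA l:leaves T. {0..<n l})"
proof -
  let ?K = "clique_tree T n" and ?X = "SIGMA l:leaves T. {0..<n l}"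
  have leaf_verts: "leaves T \<subseteq> pverts T" by (auto simp: leaves_def)
  have V: "(u, i) \<in> pverts ?K \<longleftrightarrow> u \<in> pverts T \<and> i < (if u \<in> leaves T then n u else 1)" for u i
    by (auto simp: clique_tree_def Let_def)
  have E: "((u, i), (w, j)) \<in> parcs ?K \<longleftrightarrow>
      (u, i) \<in> pverts ?K \<and> (w, j) \<in> pverts ?K \<and> (u = w \<and> i \<noteq> j \<or> (u, w) \<in> parcs T)" for u i w j
    by (auto simp: clique_tree_def Let_def)
  have V0: "(u, 0) \<in> pverts ?K" if "u \<in> pverts T" for u
    using that pos by (simp add: V)
  have wf: "pair_wf_digraph ?K" by unfold_locales (auto simp: E)
  have fin: "finite (pverts ?K)"
    using T.pair_finite_verts by (simp add: clique_tree_def Let_def)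
  have sym: "sym (parcs ?K)" using T.arcs_symmetric by (auto simp: sym_def E)
  have X_verts: "?X \<subseteq> pverts ?K" using leaf_verts by (auto simp: V)
  \<comment> \<open>Lifted walks pass through copy \<open>0\<close> of every intermediate vertex;
    the base case uses the arcs within a clique.\<close>
  have lift: "((u, i), (w, j)) \<in> (parcs ?K)\<^sup>*"
    if "(u, w) \<in> (parcs T)\<^sup>*" "(u, i) \<in> pverts ?K" "(w, j) \<in> pverts ?K" for u w i j
    using that
  proof (induction arbitrary: j)
    case base
    then show ?case by (cases "i = j") (auto simp: E)
  next
    case (step y z)
    have y: "(y, 0) \<in> pverts ?K" using V0 step.hyps(2) T.in_arcsD1 by blast
    then have "((y, 0), (z, j)) \<in> parcs ?K" using step by (simp add: E)
    then show ?case using step.IH[OF step.prems(1) y] by (meson rtrancl.rtrancl_into_rtrancl)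
  qed
  have conn: "(p, q) \<in> (parcs ?K)\<^sup>*" if "p \<in> pverts ?K" "q \<in> pverts ?K" for p q
    using that connected_T lift by (cases p; cases q) (auto simp: V)
  \<comment> \<open>All neighbours of \<open>x\<close> lie over its leaf \<open>l\<close> or over
    the unique neighbour \<open>m\<close> of \<open>l\<close>, and the vertices there are pairwise
    adjacent.\<close>
  have simplicial: "p = q \<or> (p, q) \<in> parcs ?K"
    if x: "x \<in> ?X" and px: "(p, x) \<in> parcs ?K" and xq: "(x, q) \<in> parcs ?K" for x p q
  proof -
    obtain l k u i w j where [simp]: "x = (l, k)" "p = (u, i)" "q = (w, j)"
      by (cases x; cases p; cases q)
    obtain m where m: "\<And>y. (l, y) \<in> parcs T \<longleftrightarrow> y = m" using x leaf_iff by auto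
    have m': "(m, l) \<in> parcs T" "(l, m) \<in> parcs T" using m T.arcs_symmetric by blast+
    have "u = l \<or> u = m" "w = l \<or> w = m" using px xq m T.arcs_symmetric by (auto simp: E)
    then show ?thesis using px xq m' by (auto simp: E)
  qed
  \<comment> \<open>A non-leaf \<open>v\<close> has two neighbours, and leaves from their branches
    are separated by it. As \<open>z\<close> is the only vertex over \<open>v\<close>, walks missing
    \<open>z\<close> project to walks missing \<open>v\<close>.\<close>
  have separated: "\<exists>x\<in>?X. \<exists>y\<in>?X. (x, y) \<notin> (avoiding (parcs ?K) z)\<^sup>*" if z: "z \<in> pverts ?K - ?X" for z
  proof -
    obtain v where v: "z = (v, 0)" "v \<in> pverts T" "v \<notin> leaves T"
      using z by (cases z) (auto simp: V split: if_splits)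
    obtain a where a: "(v, a) \<in> parcs T" using ex_neighbour v by blast
    then obtain b where b: "(v, b) \<in> parcs T" "a \<noteq> b" using v leaf_iff by blast
    obtain l l' where l: "l \<in> leaves T" "(a, l) \<in> (avoiding (parcs T) v)\<^sup>*"
      "l' \<in> leaves T" "(b, l') \<in> (avoiding (parcs T) v)\<^sup>*"
      using ex_leaf_in_branch a b(1) by metis
    have step: "(fst p, fst q) \<in> (avoiding (parcs T) v)\<^sup>*" if "(p, q) \<in> avoiding (parcs ?K) z" for p q
    proof -
      obtain u i w j where [simp]: "p = (u, i)" "q = (w, j)" by (cases p; cases q)
      have "u \<noteq> v" "w \<noteq> v" "u = w \<or> (u, w) \<in> parcs T"
        using that v by (auto simp: avoiding_def E V)
      then show ?thesis by (auto simp: avoiding_def)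
    qed
    have proj: "(fst p, fst q) \<in> (avoiding (parcs T) v)\<^sup>*" if "(p, q) \<in> (avoiding (parcs ?K) z)\<^sup>*" for p q
      using that by induction (auto dest: step intro: rtrancl_trans)
    have "((l, 0), (l', 0)) \<notin> (avoiding (parcs ?K) z)\<^sup>*"
    proof
      assume "((l, 0), (l', 0)) \<in> (avoiding (parcs ?K) z)\<^sup>*"
      then have "(l, l') \<in> (avoiding (parcs T) v)\<^sup>*" using proj by fastforce
      then have "(a, b) \<in> (avoiding (parcs T) v)\<^sup>*"
        using l sym_avoiding[OF sym_T] by (meson rtrancl_trans)
      then show False using adjacent_separated[OF a b] by blast
    qed
    then show ?thesis using l pos by (intro bexI[of _ "(l, 0)"] bexI[of _ "(l', 0)"]) auto
  qed
  have "\<exists>x\<in>?X. \<exists>y\<in>?X. x \<noteq> y"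
  proof (cases "\<exists>v\<in>pverts T. v \<notin> leaves T")
    case True
    then obtain v where "v \<in> pverts T" "v \<notin> leaves T" by blast
    then obtain x y where "x \<in> ?X" "y \<in> ?X" "(x, y) \<notin> (avoiding (parcs ?K) (v, 0))\<^sup>*"
      using separated[of "(v, 0)"] V0 by auto
    moreover from this have "x \<noteq> y" by blast
    ultimately show ?thesis by blast
  next
    \<comment> \<open>If all vertices are leaves, as in the tree of order 2, the ends of any arc
      do.\<close>
    case False
    obtain u where u: "u \<in> pverts T" using card_ge_2 by fastforce
    then obtain w where "(u, w) \<in> parcs T" using ex_neighbour by blast
    then have "(u, 0) \<in> ?X" "(w, 0) \<in> ?X" "u \<noteq> w"
      using False u pos T.in_arcsD2 T.no_loops' by auto
    then show ?thesis by blast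
  qed
  moreover have "finite ?X" using X_verts fin by (rule finite_subset)
  ultimately have "2 \<le> card ?X"
    by (metis card_le_Suc0_iff_eq not_less_eq_eq numeral_2_eq_2)
  then show ?thesis
    using wf fin sym conn X_verts simplicial separated by (intro simplicially_spanned.intro)
qed

end

theorem theorem6p6:
  fixes T :: "'a pair_pre_digraph" and n :: "'a \<Rightarrow> nat"
    and G :: "'b pair_pre_digraph" and s :: nat
  assumes "undirected_tree T" and "2 \<le> card (pverts T)"
    and "\<And>l. l \<in> leaves T \<Longrightarrow> 0 < n l"
    and "s = sg (clique_tree T n)"
    and "pair_graph G" and "Digraph_Component.connected (with_proj G)"
    and "real (card (pverts G)) \<le> real s / 2"
  shows "sg (clique_tree T n \<box> G) = s"
proof -
  interpret T: undirected_tree_graph T using assms by unfold_locales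
  interpret G: pair_graph G by fact
  let ?X = "SIGMA l:leaves T. {0..<n l}"
  interpret K: simplicially_spanned "clique_tree T n" ?X
    using assms(3) by (rule T.clique_tree_simplicially_spanned)
  interpret simplicially_spanned_product "clique_tree T n" ?X G
    using assms(5,6) G.pair_finite_verts connected_imp_rtrancl[OF assms(5,6)]
    by unfold_locales (auto simp: connected_conv)
  \<comment> \<open>This turns the bound on the order of \<open>G\<close> into two elements of
    \<open>?X\<close> for each vertex of \<open>G\<close>.\<close>
  have "s = card ?X" using assms(4) K.sg_eq by simp
  then show ?thesis using assms(7) sg_cart_prod by simp
qed

end
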